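(* Let $d\in\{11,19,43,67,163\}$. Then $O=\mathbb{Z}[\sqrt{-d}]$ does not satisfy property (princ), i.e. $O$ is not a PRINC domain.
   Context: Two elements $a,b$ of an integral domain $R$ form an idempotent pair if either $a(1-a)\in bR$ or $b(1-b)\in aR$. $R$ satisfies property (princ), or is a PRINC domain, if every ideal of $R$ generated by an idempotent pair is principal. *)

theory Defs
  imports Complex_Main "HOL-Algebra.Subrings"
begin

definition idempotent_pair :: "('a, 'm) ring_scheme \<Rightarrow> 'a \<Rightarrow> 'a \<Rightarrow> bool" where
  "idempotent_pair R a b \<longleftrightarrow>
     a \<in> carrier R \<and> b \<in> carrier R \<and>
     (a \<otimes>\<^bsub>R\<^esub> (\<one>\<^bsub>R\<^esub> \<ominus>\<^bsub>R\<^esub> a) \<in> PIdl\<^bsub>R\<^esub> b \<or> b \<otimes>\<^bsub>R\<^esub> (\<one>\<^bsub>R\<^esub> \<ominus>\<^bsub>R\<^esub> b) \<in> PIdl\<^bsub>R\<^esub> a)"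

(* Only the property (princ) itself; a PRINC domain is an R with both "domain R" and "princ R". *)
definition princ :: "('a, 'm) ring_scheme \<Rightarrow> bool" where
  "princ R \<longleftrightarrow> (\<forall>a b. idempotent_pair R a b \<longrightarrow> principalideal (Idl\<^bsub>R\<^esub> {a, b}) R)"

definition complex_ring :: "complex ring" where
  "complex_ring = \<lparr>carrier = UNIV, mult = (*), one = 1, zero = 0, add = (+)\<rparr>"

(* Z[sqrt(-d)] inside the complex numbers; csqrt (- d) = i * sqrt d. *)
definition Z_sqrt_neg :: "nat \<Rightarrow> complex ring" where
  "Z_sqrt_neg d = complex_ring
     \<lparr>carrier := {of_int x + of_int y * csqrt (- of_nat d) | x y. True}\<rparr>"

lemma complex_ring_simps [simp]:
  "carrier complex_ring = UNIV" "x \<otimes>\<^bsub>complex_ring\<^esub> y = x * y" "\<one>\<^bsub>complex_ring\<^esub> = 1"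
  "\<zero>\<^bsub>complex_ring\<^esub> = 0" "x \<oplus>\<^bsub>complex_ring\<^esub> y = x + y"
  by (simp_all add: complex_ring_def)

lemma field_complex_ring: "field complex_ring"
proof (rule cring.cring_fieldI2)
  show "cring complex_ring"
  proof (rule cringI)
    show "abelian_group complex_ring"
      by (rule abelian_groupI) (auto simp: algebra_simps intro: exI[of _ "- x" for x] right_minus)
    show "Group.comm_monoid complex_ring"
      by (rule comm_monoidI) auto
  qed (auto simp: algebra_simps)
  show "\<exists>b\<in>carrier complex_ring. a \<otimes>\<^bsub>complex_ring\<^esub> b = \<one>\<^bsub>complex_ring\<^esub>"
    if "a \<noteq> \<zero>\<^bsub>complex_ring\<^esub>" for a
    using that by (auto intro: exI[of _ "inverse a"])
qed auto

interpretation complex_ring: field complex_ring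
  by (rule field_complex_ring)

lemma complex_ring_a_inv [simp]: "\<ominus>\<^bsub>complex_ring\<^esub> x = - x"
  by (rule complex_ring.minus_equality) auto

lemma subring_Z_sqrt_neg: "subring (carrier (Z_sqrt_neg d)) complex_ring"
proof (rule complex_ring.subringI)
  let ?s = "csqrt (- of_nat d)"
  have s: "?s * ?s = - of_nat d"
    using power2_csqrt[of "- of_nat d"] by (simp only: power2_eq_square)
  have I: "of_int x + of_int y * ?s \<in> carrier (Z_sqrt_neg d)" for x y
    by (auto simp: Z_sqrt_neg_def)
  show "\<one>\<^bsub>complex_ring\<^esub> \<in> carrier (Z_sqrt_neg d)"
    using I[of 1 0] by simp
  show "\<ominus>\<^bsub>complex_ring\<^esub> h \<in> carrier (Z_sqrt_neg d)" if h: "h \<in> carrier (Z_sqrt_neg d)" for h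
  proof -
    obtain x y where "h = of_int x + of_int y * ?s"
      using h by (auto simp: Z_sqrt_neg_def)
    then show ?thesis using I[of "-x" "-y"] by simp
  qed
  fix h k assume "h \<in> carrier (Z_sqrt_neg d)" "k \<in> carrier (Z_sqrt_neg d)"
  then obtain x y u v where hk: "h = of_int x + of_int y * ?s" "k = of_int u + of_int v * ?s"
    unfolding Z_sqrt_neg_def by auto
  have "h + k = of_int (x + u) + of_int (y + v) * ?s"
    by (simp add: hk algebra_simps del: csqrt_of_real_nonpos)
  then show "h \<oplus>\<^bsub>complex_ring\<^esub> k \<in> carrier (Z_sqrt_neg d)"
    using I[of "x + u" "y + v"] by (simp only: complex_ring_simps)
  have "h * k = of_int x * of_int u + of_int y * of_int v * (?s * ?s)
      + (of_int x * of_int v + of_int y * of_int u) * ?s"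
    unfolding hk by (simp only: algebra_simps)
  also have "\<dots> = of_int (x * u - y * v * int d) + of_int (x * v + y * u) * ?s"
    unfolding s by simp
  finally show "h \<otimes>\<^bsub>complex_ring\<^esub> k \<in> carrier (Z_sqrt_neg d)"
    using I[of "x * u - y * v * int d" "x * v + y * u"] by (simp only: complex_ring_simps)
qed auto

lemma domain_Z_sqrt_neg: "domain (Z_sqrt_neg d)"
  using complex_ring.subring_is_domain[OF subring_Z_sqrt_neg[of d]]
  by (simp add: Z_sqrt_neg_def)

end

theory Submission
  imports Defs "HOL-Computational_Algebra.Primes"
begin

text \<open>
  In all five cases \<open>d = 4 * p - 1\<close> for an odd prime \<open>p\<close>. Write \<open>s\<close> for the square root of \<open>- d\<close> and
  put \<open>k = (p + 1) / 2\<close>, \<open>a = k * (1 + s)\<close>. Since \<open>a\<close> is \<open>0\<close> modulo the prime ideal \<open>P = (p, 1 + s)\<close>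
  and \<open>1\<close> modulo its conjugate, \<open>p\<close> divides \<open>a * (1 - a)\<close>, so \<open>a\<close> and \<open>p\<close> form an idempotent pair
  generating \<open>P\<close>. A generator of \<open>P\<close> would have norm \<open>p\<close>, but \<open>x\<^sup>2 + d * y\<^sup>2 = p\<close> has no
  solution because \<open>p < d\<close> and \<open>p\<close> is not a square.
\<close>

definition Z_sqrt_elem :: "nat \<Rightarrow> int \<Rightarrow> int \<Rightarrow> complex" where
  "Z_sqrt_elem d x y = of_int x + of_int y * csqrt (- of_nat d)"

lemma Z_sqrt_neg_simps [simp]:
  "x \<otimes>\<^bsub>Z_sqrt_neg d\<^esub> y = x * y" "\<one>\<^bsub>Z_sqrt_neg d\<^esub> = 1"
  "\<zero>\<^bsub>Z_sqrt_neg d\<^esub> = 0" "x \<oplus>\<^bsub>Z_sqrt_neg d\<^esub> y = x + y"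
  by (simp_all add: Z_sqrt_neg_def complex_ring_def)

lemma carrier_Z_sqrt_neg: "carrier (Z_sqrt_neg d) = {Z_sqrt_elem d x y | x y. True}"
  by (simp add: Z_sqrt_neg_def Z_sqrt_elem_def)

lemma Z_sqrt_elem_in_carrier [simp]: "Z_sqrt_elem d x y \<in> carrier (Z_sqrt_neg d)"
  by (auto simp: carrier_Z_sqrt_neg)

lemma Z_sqrt_elem_cases:
  assumes "z \<in> carrier (Z_sqrt_neg d)"
  obtains x y where "z = Z_sqrt_elem d x y"
  using assms by (auto simp: carrier_Z_sqrt_neg)

lemma Z_sqrt_elem_add: "Z_sqrt_elem d x y + Z_sqrt_elem d u v = Z_sqrt_elem d (x + u) (y + v)"
  unfolding Z_sqrt_elem_def by (simp only: of_int_add algebra_simps)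

lemma Z_sqrt_elem_mult:
  "Z_sqrt_elem d x y * Z_sqrt_elem d u v = Z_sqrt_elem d (x * u - int d * y * v) (x * v + y * u)"
proof -
  let ?s = "csqrt (- of_nat d)"
  have s: "?s * ?s = - of_nat d"
    using power2_csqrt[of "- of_nat d"] by (simp only: power2_eq_square)
  have "Z_sqrt_elem d x y * Z_sqrt_elem d u v
      = of_int x * of_int u + of_int y * of_int v * (?s * ?s)
        + (of_int x * of_int v + of_int y * of_int u) * ?s"
    unfolding Z_sqrt_elem_def by (simp only: algebra_simps)
  then show ?thesis
    unfolding s Z_sqrt_elem_def by (simp add: algebra_simps)
qed

text \<open>For \<open>d > 0\<close> the root is \<open>\<i> * sqrt d\<close>, so real and imaginary
  parts determine both coordinates.\<close>

lemma Z_sqrt_elem_inject: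
  assumes "d > 0"
  shows "Z_sqrt_elem d x y = Z_sqrt_elem d u v \<longleftrightarrow> x = u \<and> y = v"
proof -
  have s: "csqrt (- of_nat d) = \<i> * of_real (sqrt (real d))"
    using csqrt_of_real_nonpos[of "- real d"] by simp
  have "Re (Z_sqrt_elem d x y) = of_int x" "Im (Z_sqrt_elem d x y) = of_int y * sqrt (real d)" for x y
    unfolding Z_sqrt_elem_def s by simp_all
  then show ?thesis
    using assms by (auto simp: complex_eq_iff)
qed

text \<open>Membership in a principal ideal is divisibility, and the norm
  \<open>x\<^sup>2 + d * y\<^sup>2\<close> is multiplicative.\<close>

lemma Z_sqrt_norm_dvd:
  assumes "d > 0" "Z_sqrt_elem d x y \<in> PIdl\<^bsub>Z_sqrt_neg d\<^esub> (Z_sqrt_elem d u v)"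
  shows "u\<^sup>2 + int d * v\<^sup>2 dvd x\<^sup>2 + int d * y\<^sup>2"
proof -
  obtain r t where "Z_sqrt_elem d x y = Z_sqrt_elem d r t * Z_sqrt_elem d u v"
    using assms(2) by (auto simp: cgenideal_def carrier_Z_sqrt_neg)
  then have xy: "x = r * u - int d * t * v" "y = r * v + t * u"
    using assms(1) by (simp_all add: Z_sqrt_elem_mult Z_sqrt_elem_inject)
  have "x\<^sup>2 + int d * y\<^sup>2 = (u\<^sup>2 + int d * v\<^sup>2) * (r\<^sup>2 + int d * t\<^sup>2)"
    unfolding xy by (simp add: power2_eq_square algebra_simps)
  then show ?thesis by simp
qed

text \<open>The sum of the two principal ideals is an ideal containing \<open>a\<close> and
  \<open>b\<close>, so it contains the ideal they generate.\<close>

lemma (in cring) genideal_pair: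
  assumes "a \<in> carrier R" "b \<in> carrier R" "g \<in> Idl {a, b}"
  obtains r t where "r \<in> carrier R" "t \<in> carrier R" "g = r \<otimes> a \<oplus> t \<otimes> b"
proof -
  have zero: "\<zero> \<in> PIdl c" if "c \<in> carrier R" for c
    using that by (auto simp: cgenideal_def intro!: exI[of _ \<zero>])
  have "a \<in> PIdl a <+>\<^bsub>R\<^esub> PIdl b"
    using assms zero[of b] cgenideal_self[of a]
    unfolding set_add_def' by (fastforce simp: r_zero)
  moreover have "b \<in> PIdl a <+>\<^bsub>R\<^esub> PIdl b"
    using assms zero[of a] cgenideal_self[of b]
    unfolding set_add_def' by (fastforce simp: l_zero)
  moreover have "ideal (PIdl a <+>\<^bsub>R\<^esub> PIdl b) R"
    using assms by (intro add_ideals cgenideal_ideal)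
  ultimately have "g \<in> PIdl a <+>\<^bsub>R\<^esub> PIdl b"
    using assms(3) genideal_minimal[of "PIdl a <+>\<^bsub>R\<^esub> PIdl b" "{a, b}"] by auto
  then show ?thesis
    using that by (auto simp: set_add_def' cgenideal_def)
qed

lemma not_princ_Z_sqrt_neg:
  fixes p :: nat
  assumes "prime p" "odd p"
  shows "\<not> princ (Z_sqrt_neg (4 * p - 1))"
proof
  define d where "d = 4 * p - 1"
  assume princ: "princ (Z_sqrt_neg (4 * p - 1))"
  let ?R = "Z_sqrt_neg d"
  interpret R: "domain" ?R by (rule domain_Z_sqrt_neg)
  have p1: "p > 1" using assms(1) by (rule prime_gt_1_nat)
  have d: "int d = 4 * int p - 1" "d > 0" using p1 by (auto simp: d_def)
  obtain j where "p = 2 * j + 1" using assms(2) by (rule oddE)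
  then have k: "int p = 2 * (int j + 1) - 1" by simp
  \<comment> \<open>Since \<open>2 * k = p + 1\<close>, this \<open>k\<close> is an inverse of 2
    modulo \<open>p\<close>.\<close>
  define k where "k = int j + 1"
  note k = k[folded k_def]
  define a where "a = Z_sqrt_elem d k k"
  define b where "b = Z_sqrt_elem d (int p) 0"
  have aR: "a \<in> carrier ?R" and bR: "b \<in> carrier ?R" by (simp_all add: a_def b_def)
  have neg: "\<ominus>\<^bsub>?R\<^esub> a = Z_sqrt_elem d (- k) (- k)"
    by (rule R.minus_equality) (simp_all add: a_def Z_sqrt_elem_add, simp add: Z_sqrt_elem_def)
  have one: "1 = Z_sqrt_elem d 1 0" by (simp add: Z_sqrt_elem_def)
  have "a * (1 + \<ominus>\<^bsub>?R\<^esub> a) = Z_sqrt_elem d (k * (1 - k) - int d * k * (- k)) (k * (- k) + k * (1 - k))"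
    unfolding neg one unfolding a_def Z_sqrt_elem_add Z_sqrt_elem_mult by simp
  \<comment> \<open>Here \<open>d = 8 * k - 5\<close>, so the left side is
    \<open>k * (8 * k\<^sup>2 - 6 * k + 1)\<close>, which factors as
    \<open>k * (4 * k - 1) * (2 * k - 1)\<close>.\<close>
  also have "k * (1 - k) - int d * k * (- k) = (4 * k - 1) * k * int p"
    unfolding d(1) k by (simp add: algebra_simps)
  also have "k * (- k) + k * (1 - k) = - k * int p"
    unfolding k by (simp add: algebra_simps)
  also have "Z_sqrt_elem d ((4 * k - 1) * k * int p) (- k * int p) = Z_sqrt_elem d ((4 * k - 1) * k) (- k) * b"
    unfolding b_def Z_sqrt_elem_mult by simp
  finally have "a * (1 + \<ominus>\<^bsub>?R\<^esub> a) = Z_sqrt_elem d ((4 * k - 1) * k) (- k) * b" .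
  then have "a * (1 + \<ominus>\<^bsub>?R\<^esub> a) \<in> PIdl\<^bsub>?R\<^esub> b"
    by (auto simp: cgenideal_def)
  then have "idempotent_pair ?R a b"
    using aR bR by (auto simp: idempotent_pair_def a_minus_def)
  then have "principalideal (Idl\<^bsub>?R\<^esub> {a, b}) ?R"
    using princ by (auto simp: princ_def d_def)
  then obtain g where gR: "g \<in> carrier ?R" and g: "Idl\<^bsub>?R\<^esub> {a, b} = Idl\<^bsub>?R\<^esub> {g}"
    using principalideal.generate by blast
  obtain x y where gxy: "g = Z_sqrt_elem d x y"
    using gR by (rule Z_sqrt_elem_cases)
  define N where "N = x\<^sup>2 + int d * y\<^sup>2"
  have "a \<in> PIdl\<^bsub>?R\<^esub> g" "b \<in> PIdl\<^bsub>?R\<^esub> g"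
    using R.genideal_self[of "{a, b}"] aR bR gR g R.cgenideal_eq_genideal[OF gR] by auto
  then have "N dvd k\<^sup>2 + int d * k\<^sup>2" and Nb: "N dvd (int p)\<^sup>2"
    using Z_sqrt_norm_dvd[OF d(2)] unfolding a_def b_def gxy N_def by fastforce+
  \<comment> \<open>The norm of \<open>a\<close> is \<open>k\<^sup>2 * (1 + d)\<close>, and
    \<open>1 + d = 4 * p\<close>.\<close>
  then have Na: "N dvd int p * (2 * k)\<^sup>2"
    unfolding d(1) by (simp add: algebra_simps power2_eq_square)
  \<comment> \<open>Every element of the ideal has coordinates congruent modulo \<open>p\<close>,
    because \<open>d\<close> is \<open>-1\<close> modulo \<open>p\<close>. For the same reason its
    norm is \<open>x\<^sup>2 - y\<^sup>2\<close> modulo \<open>p\<close>.\<close>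
  have pN: "int p dvd N"
  proof -
    have "g \<in> Idl\<^bsub>?R\<^esub> {a, b}"
      using R.genideal_self[of "{g}"] gR g by auto
    then obtain r t where rt: "r \<in> carrier ?R" "t \<in> carrier ?R" and "g = r \<otimes>\<^bsub>?R\<^esub> a \<oplus>\<^bsub>?R\<^esub> t \<otimes>\<^bsub>?R\<^esub> b"
      using R.genideal_pair[OF aR bR] by blast
    moreover obtain r1 r2 where "r = Z_sqrt_elem d r1 r2" using rt(1) by (rule Z_sqrt_elem_cases)
    moreover obtain t1 t2 where "t = Z_sqrt_elem d t1 t2" using rt(2) by (rule Z_sqrt_elem_cases)
    ultimately have "x = r1 * k - int d * r2 * k + t1 * int p" "y = r1 * k + r2 * k + t2 * int p"
      using d(2) by (simp_all add: gxy a_def b_def Z_sqrt_elem_mult Z_sqrt_elem_add Z_sqrt_elem_inject)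
    then have "x - y = int p * (t1 - t2 - 4 * r2 * k)"
      unfolding d(1) by (simp add: algebra_simps)
    moreover have "N = (x - y) * (x + y) + int p * (4 * y\<^sup>2)"
      unfolding N_def d(1) by (simp add: power2_eq_square algebra_simps)
    ultimately show ?thesis by (metis dvd_add dvd_triv_left dvd_mult2)
  qed
  then obtain m where m: "N = int p * m" ..
  \<comment> \<open>Cancelling \<open>p\<close> in both divisibilities leaves \<open>m\<close> a
    common divisor of \<open>p = 2 * k - 1\<close> and \<open>(2 * k)\<^sup>2\<close>, which are
    coprime.\<close>
  have "m dvd int p" "m dvd (2 * k)\<^sup>2"
    using Nb Na p1 by (auto simp: m power2_eq_square)
  moreover have "coprime (int p) ((2 * k)\<^sup>2)"
    unfolding k using coprime_diff_one_left[of "2 * k"] by (simp only: coprime_power_right_iff simp_thms)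
  ultimately have "is_unit m"
    by (rule coprime_common_divisor[rotated, of _ "int p" "(2 * k)\<^sup>2"])
  \<comment> \<open>The sign excludes the unit \<open>-1\<close>, so \<open>m = 1\<close>.\<close>
  moreover have "m \<ge> 0"
  proof -
    have "int p * m \<ge> 0" unfolding m[symmetric] N_def by simp
    then show ?thesis using p1 by (simp add: zero_le_mult_iff)
  qed
  ultimately have Np: "x\<^sup>2 + int d * y\<^sup>2 = int p"
    using m by (auto simp: N_def)
  have "y = 0"
  proof (rule ccontr)
    assume "y \<noteq> 0"
    then have "1 \<le> y\<^sup>2" by (simp add: int_one_le_iff_zero_less)
    then have "int d * 1 \<le> int d * y\<^sup>2" by (rule mult_left_mono) simp
    then have "int d \<le> int p" using Np zero_le_power2[of x] by linarith
    then show False using d p1 by simp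
  qed
  then have "int p = x ^ 2" using Np by simp
  moreover have "prime (int p)" using assms(1) by simp
  ultimately show False by (simp add: prime_power_iff)
qed

theorem proposition3p3:
  fixes d :: nat
  assumes "d \<in> {11, 19, 43, 67, 163}"
  shows "\<not> princ (Z_sqrt_neg d)"
proof -
  \<comment> \<open>These are the values \<open>p = (d + 1) / 4\<close> for the five given
    \<open>d\<close>.\<close>
  have "prime (3::nat)" "prime (5::nat)" "prime (11::nat)" "prime (17::nat)" "prime (41::nat)"
    by simp_all
  then show ?thesis
    using assms not_princ_Z_sqrt_neg[of 3] not_princ_Z_sqrt_neg[of 5] not_princ_Z_sqrt_neg[of 11]
      not_princ_Z_sqrt_neg[of 17] not_princ_Z_sqrt_neg[of 41]
    by auto
qed

end
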